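(* Let $(c_s)_{s\in\mathbb Z}$ be complex numbers with $c_0=0$ and $c_{-s}=-c_s$ for all $s$, and let $A_n=(c_{j-i})_{i,j=1}^n$. For $r\ge1$ define the $r\times r$ Toeplitz-minus-Hankel matrix $$B_r=\bigl(c_{j-i}-c_{2r+1-i-j}\bigr)_{i,j=1}^r.$$ Then $$\det A_{2r}=\det(B_r)^2,\qquad \operatorname{Pf}(A_{2r})=(-1)^r\det B_r,$$ and, for odd order, $\det A_{2r+1}=0$.
   Context: The standard Pfaffian convention is used: for a skew-symmetric $2r\times2r$ matrix $A=(\alpha_{ij})$, $\operatorname{Pf}(A)=\frac1{2^rr!}\sum_{\sigma\in\mathfrak S_{2r}}\operatorname{sgn}(\sigma)\prod_{i=1}^r\alpha_{\sigma(2i-1),\sigma(2i)}$. *)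

theory Defs
  imports "Jordan_Normal_Form.Determinant"
begin

text \<open>Matrices of \<open>Jordan_Normal_Form\<close> are indexed from 0, so the entry at \<open>(i, j)\<close> below is the
  entry in row \<open>i + 1\<close> and column \<open>j + 1\<close> of the usual notation.\<close>

definition toeplitz_mat :: "(int \<Rightarrow> 'a) \<Rightarrow> nat \<Rightarrow> 'a mat" where
  "toeplitz_mat c n = mat n n (\<lambda>(i, j). c (int (j + 1) - int (i + 1)))"

definition toeplitz_minus_hankel_mat :: "(int \<Rightarrow> 'a::minus) \<Rightarrow> nat \<Rightarrow> 'a mat" where
  "toeplitz_minus_hankel_mat c r =
     mat r r (\<lambda>(i, j). c (int (j + 1) - int (i + 1)) - c (2 * int r + 1 - int (i + 1) - int (j + 1)))"

text \<open>The Pfaffian is meaningful for skew-symmetric matrices of even dimension \<open>2 * r\<close>; the value of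
  this total function on other matrices carries no meaning. With indices from 0, the pair
  \<open>(2 * i - 1, 2 * i)\<close> for \<open>i = 1, \<dots>, r\<close> becomes \<open>(2 * i, 2 * i + 1)\<close> for \<open>i < r\<close>.\<close>

definition pfaffian :: "'a::field_char_0 mat \<Rightarrow> 'a" where
  "pfaffian A = (let r = dim_row A div 2 in
     1 / (2 ^ r * fact r) *
     (\<Sum>p | p permutes {0..<2 * r}. signof p * (\<Prod>i = 0..<r. A $$ (p (2 * i), p (2 * i + 1)))))"

end

theory Submission
  imports Defs
begin

text \<open>Let \<open>A = A\<^bsub>2r\<^esub>\<close>, \<open>B = B\<^bsub>r\<^esub>\<close> and write \<open>i' = 2 r + 1 - i\<close>. Since \<open>A\<close> changes its sign under reversal of
  both indices, the bilinear form of \<open>A\<close> vanishes on the span of the vectors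
  \<open>e\<^sub>i + e\<^bsub>i'\<^esub>\<close>, and it pairs \<open>e\<^sub>i + e\<^bsub>i'\<^esub>\<close> with \<open>e\<^bsub>j'\<^esub>\<close> to \<open>- B i j\<close>. The Pfaffian is multiplied by
  the determinant under a congruence, which reduces it to that of a matrix with a vanishing diagonal
  block, namely to \<open>det (- B)\<close>. The same elimination gives \<open>det A\<close>, as the complementary block is
  \<open>B\<close> transposed. In odd order, skew-symmetry alone forces the determinant to be 0.\<close>

section \<open>Pfaffian sums: relabelling and congruence\<close>

text \<open>Leaving out the factor 1 / (2^r r!) avoids division, so the laws below can be proved
  over any commutative ring. Entries given as a function make relabelling a mere
  composition.\<close>

definition pf_sum :: "nat \<Rightarrow> (nat \<Rightarrow> nat \<Rightarrow> 'a) \<Rightarrow> 'a::comm_ring_1" where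
  "pf_sum r a =
     (\<Sum>p | p permutes {0..<2 * r}. signof p * (\<Prod>i = 0..<r. a (p (2 * i)) (p (2 * i + 1))))"

lemma pfaffian_eq_pf_sum:
  assumes "A \<in> carrier_mat (2 * r) (2 * r)"
  shows "pfaffian A = pf_sum r (\<lambda>i j. A $$ (i, j)) / (2 ^ r * fact r)"
proof -
  have "dim_row A div 2 = r"
    using assms by auto
  then show ?thesis
    by (simp only: pfaffian_def pf_sum_def Let_def times_divide_eq_left mult_1_left)
qed

lemma pf_sum_cong:
  assumes "\<And>i j. i < 2 * r \<Longrightarrow> j < 2 * r \<Longrightarrow> a i j = b i j"
  shows "pf_sum r a = pf_sum r b"
  unfolding pf_sum_def
proof (intro sum.cong arg_cong2[where f = "(*)"] prod.cong refl)
  fix p i assume "p \<in> {p. p permutes {0..<2 * r}}" "i \<in> {0..<r}"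
  then have "p (2 * i) \<in> {0..<2 * r}" "p (2 * i + 1) \<in> {0..<2 * r}"
    by (auto simp: permutes_in_image)
  then show "a (p (2 * i)) (p (2 * i + 1)) = b (p (2 * i)) (p (2 * i + 1))"
    using assms by simp
qed

lemma signof_mult_signof: "(signof p * signof p :: 'a::ring_1) = 1"
  by (metis of_int_1 of_int_mult sign_idempotent)

text \<open>Reindexing the sum by \<open>q \<circ> p\<close> produces the sign of \<open>q\<close>,
  which is its own inverse.\<close>

lemma pf_sum_relabel:
  assumes q: "q permutes {0..<2 * r}"
  shows "pf_sum r (\<lambda>i j. a (q i) (q j)) = signof q * pf_sum r a"
proof -
  have "pf_sum r a = (\<Sum>p | p permutes {0..<2 * r}.
      signof (q \<circ> p) * (\<Prod>i = 0..<r. a ((q \<circ> p) (2 * i)) ((q \<circ> p) (2 * i + 1))))"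
    unfolding pf_sum_def by (rule setum_permutations_compose_left[OF q])
  also have "\<dots> = signof q * pf_sum r (\<lambda>i j. a (q i) (q j))"
    unfolding pf_sum_def sum_distrib_left
    using q by (intro sum.cong) (auto simp: signof_compose mult.assoc)
  finally have eq: "pf_sum r a = signof q * pf_sum r (\<lambda>i j. a (q i) (q j))" .
  show ?thesis
    unfolding eq mult.assoc[symmetric] signof_mult_signof mult_1_left ..
qed

lemma prod_double: "(\<Prod>m<2 * r. h m) = (\<Prod>i = 0..<r. h (2 * i) * h (2 * i + 1 :: nat) :: 'a::comm_monoid_mult)"
  by (induction r) (auto simp: mult.assoc)

text \<open>Expanding all factors writes the left side as a combination of determinants of matrices
  whose columns are columns of \<open>S\<close>, with coefficients depending on \<open>a\<close>
  only. By multiplicativity \<open>det S\<close> splits off from each of them.\<close>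

lemma pf_sum_congruence:
  fixes S a :: "nat \<Rightarrow> nat \<Rightarrow> 'a::comm_ring_1"
  shows "pf_sum r (\<lambda>i j. \<Sum>k<2 * r. \<Sum>l<2 * r. S i k * a k l * S j l) =
    det (mat (2 * r) (2 * r) (\<lambda>(i, j). S i j)) * pf_sum r a"
proof -
  let ?n = "2 * r"
  let ?G = "PiE {0..<r} (\<lambda>_. {..<?n} \<times> {..<?n})"
  \<comment> \<open>A choice \<open>g\<close> of one index pair per factor is read as a list of 2r
    columns: the pair \<open>g i\<close> fills positions 2i and 2i + 1.\<close>
  define f :: "(nat \<Rightarrow> nat \<times> nat) \<Rightarrow> nat \<Rightarrow> nat"
    where "f g m = (if even m then fst (g (m div 2)) else snd (g (m div 2)))" for g m
  have f_less: "f g m < ?n" if "g \<in> ?G" "m < ?n" for g m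
  proof -
    have "g (m div 2) \<in> {..<?n} \<times> {..<?n}" using that by (intro PiE_mem[OF that(1)]) auto
    then show ?thesis by (auto simp: f_def)
  qed
  \<comment> \<open>Only the determinant depends on \<open>T\<close>, and it is multiplicative in \<open>T\<close>; so it suffices to
    compare \<open>T = S\<close> with \<open>T\<close> the identity.\<close>
  have expand: "pf_sum r (\<lambda>i j. \<Sum>k<?n. \<Sum>l<?n. T i k * a k l * T j l) =
      (\<Sum>g\<in>?G. (\<Prod>i = 0..<r. a (fst (g i)) (snd (g i))) * det (mat ?n ?n (\<lambda>(i, m). T i (f g m))))"
    for T :: "nat \<Rightarrow> nat \<Rightarrow> 'a"
  proof -
    have "(\<Prod>i = 0..<r. \<Sum>k<?n. \<Sum>l<?n. T (p (2 * i)) k * a k l * T (p (2 * i + 1)) l) =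
        (\<Sum>g\<in>?G. (\<Prod>i = 0..<r. a (fst (g i)) (snd (g i))) * (\<Prod>m<?n. T (p m) (f g m)))" for p
    proof -
      have "(\<Prod>i = 0..<r. \<Sum>k<?n. \<Sum>l<?n. T (p (2 * i)) k * a k l * T (p (2 * i + 1)) l) =
        (\<Prod>i = 0..<r. \<Sum>y\<in>{..<?n} \<times> {..<?n}.
           T (p (2 * i)) (fst y) * a (fst y) (snd y) * T (p (2 * i + 1)) (snd y))"
        by (simp add: sum.cartesian_product split_def)
      also have "\<dots> = (\<Sum>g\<in>?G. \<Prod>i = 0..<r.
           T (p (2 * i)) (fst (g i)) * a (fst (g i)) (snd (g i)) * T (p (2 * i + 1)) (snd (g i)))"
        by (rule prod_sum_PiE) auto
      also have "\<dots> = (\<Sum>g\<in>?G. (\<Prod>i = 0..<r. a (fst (g i)) (snd (g i))) * (\<Prod>m<?n. T (p m) (f g m)))"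
        by (simp only: prod_double) (simp add: f_def prod.distrib mult_ac)
      finally show ?thesis .
    qed
    then have "pf_sum r (\<lambda>i j. \<Sum>k<?n. \<Sum>l<?n. T i k * a k l * T j l) =
      (\<Sum>p | p permutes {0..<?n}. \<Sum>g\<in>?G.
        (\<Prod>i = 0..<r. a (fst (g i)) (snd (g i))) * (signof p * (\<Prod>m<?n. T (p m) (f g m))))"
      unfolding pf_sum_def by (simp add: sum_distrib_left mult_ac)
    also have "\<dots> = (\<Sum>g\<in>?G. (\<Prod>i = 0..<r. a (fst (g i)) (snd (g i))) *
        (\<Sum>p | p permutes {0..<?n}. signof p * (\<Prod>m<?n. T (p m) (f g m))))"
      unfolding sum_distrib_left by (rule sum.swap)
    also have "\<dots> = (\<Sum>g\<in>?G. (\<Prod>i = 0..<r. a (fst (g i)) (snd (g i))) *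
        det (mat ?n ?n (\<lambda>(i, m). T i (f g m))))"
    proof (intro sum.cong refl arg_cong2[where f = "(*)"])
      fix g
      have "(\<Prod>m<?n. mat ?n ?n (\<lambda>(i, m). T i (f g m)) $$ (p m, m)) = (\<Prod>m<?n. T (p m) (f g m))"
        if "p permutes {0..<?n}" for p
        using permutes_in_image[OF that] by (intro prod.cong) auto
      then show "(\<Sum>p | p permutes {0..<?n}. signof p * (\<Prod>m<?n. T (p m) (f g m))) =
          det (mat ?n ?n (\<lambda>(i, m). T i (f g m)))"
        by (subst det_col[of _ ?n]) auto
    qed
    finally show ?thesis .
  qed
  let ?d = "\<lambda>i j. if i = j then 1 else 0 :: 'a"
  have "det (mat ?n ?n (\<lambda>(i, m). S i (f g m))) =
      det (mat ?n ?n (\<lambda>(i, j). S i j)) * det (mat ?n ?n (\<lambda>(i, m). ?d i (f g m)))" if "g \<in> ?G" for g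
  proof -
    \<comment> \<open>Selecting columns of \<open>S\<close> is right multiplication by the 0/1
      matrix whose column m has its 1 in row \<open>f g m\<close>.\<close>
    have "mat ?n ?n (\<lambda>(i, m). S i (f g m)) =
        mat ?n ?n (\<lambda>(i, j). S i j) * mat ?n ?n (\<lambda>(i, m). ?d i (f g m))"
      using f_less[OF that]
      by (intro eq_matI) (auto simp: scalar_prod_def if_distrib[where f = "(*) x" for x] cong: if_cong)
    then show ?thesis by (simp add: det_mult[of _ ?n])
  qed
  then have "pf_sum r (\<lambda>i j. \<Sum>k<?n. \<Sum>l<?n. S i k * a k l * S j l) =
    det (mat ?n ?n (\<lambda>(i, j). S i j)) * pf_sum r (\<lambda>i j. \<Sum>k<?n. \<Sum>l<?n. ?d i k * a k l * ?d j l)"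
    unfolding expand sum_distrib_left by (intro sum.cong) (auto simp: mult_ac)
  also have "pf_sum r (\<lambda>i j. \<Sum>k<?n. \<Sum>l<?n. ?d i k * a k l * ?d j l) = pf_sum r a"
  proof (rule pf_sum_cong)
    fix i j assume ij: "i < ?n" "j < ?n"
    have "(\<Sum>k<?n. \<Sum>l<?n. ?d i k * a k l * ?d j l) =
        (\<Sum>k<?n. \<Sum>l<?n. if j = l then (if i = k then a k l else 0) else 0)"
      by (intro sum.cong) auto
    also have "\<dots> = a i j"
      using ij by (simp add: sum.delta')
    finally show "(\<Sum>k<?n. \<Sum>l<?n. ?d i k * a k l * ?d j l) = a i j" .
  qed
  finally show ?thesis .
qed

section \<open>Evaluation when one diagonal block vanishes\<close>

text \<open>Exchanging the arguments of one factor costs a sign, which composing \<open>p\<close>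
  with a transposition makes up for; so each of the r factors contributes a 2. A skew matrix may
  thus be replaced by a more convenient \<open>N\<close> that antisymmetrizes to it.\<close>

lemma pf_sum_antisymmetrize:
  fixes N :: "nat \<Rightarrow> nat \<Rightarrow> 'a::comm_ring_1"
  shows "pf_sum r (\<lambda>i j. N i j - N j i) = 2 ^ r * pf_sum r N"
proof -
  let ?P = "{p. p permutes {0..<2 * r}}"
  \<comment> \<open>Only the first \<open>k\<close> factors are antisymmetrized, so \<open>G\<close>
    interpolates between the two sides as \<open>k\<close> runs from 0 to \<open>r\<close>.\<close>
  define t where "t k p i = (if i < k then N (p (2 * i)) (p (2 * i + 1)) - N (p (2 * i + 1)) (p (2 * i))
      else N (p (2 * i)) (p (2 * i + 1)))" for k i :: nat and p
  define G where "G k = (\<Sum>p\<in>?P. signof p * (\<Prod>i = 0..<r. t k p i))" for k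
  have step: "G (Suc k) = 2 * G k" if k: "k < r" for k
  proof -
    define q where "q = Transposition.transpose (2 * k) (2 * k + 1)"
    have q: "q permutes {0..<2 * r}"
      unfolding q_def using k by (intro permutes_swap_id) auto
    have q_other: "q (2 * i) = 2 * i" "q (Suc (2 * i)) = Suc (2 * i)" if "i \<noteq> k" for i
      using that by (auto simp: q_def Transposition.transpose_def)
    have q_k: "q (2 * k) = Suc (2 * k)" "q (Suc (2 * k)) = 2 * k"
      by (auto simp: q_def)
    define R where "R p = (\<Prod>i\<in>{0..<r} - {k}. t k p i)" for p
    have split: "(\<Prod>i = 0..<r. t m p i) = t m p k * (\<Prod>i\<in>{0..<r} - {k}. t m p i)" for m p
      using k by (intro prod.remove) auto
    have R_Suc: "(\<Prod>i\<in>{0..<r} - {k}. t (Suc k) p i) = R p" for p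
      unfolding R_def by (intro prod.cong) (auto simp: t_def)
    have R_q: "R (p \<circ> q) = R p" for p
      unfolding R_def by (intro prod.cong) (auto simp: t_def q_other)
    have sgn: "signof (p \<circ> q) = (- signof p :: 'a)" if "p \<in> ?P" for p
      using that q by (simp add: signof_compose) (simp add: q_def sign_swap_id)
    let ?N = "\<lambda>p. N (p (2 * k)) (p (2 * k + 1))"
    let ?N' = "\<lambda>p. N (p (2 * k + 1)) (p (2 * k))"
    have G: "G k = (\<Sum>p\<in>?P. signof p * (?N p * R p))"
      unfolding G_def split R_def by (simp add: t_def)
    also have "\<dots> = (\<Sum>p\<in>?P. signof (p \<circ> q) * (?N (p \<circ> q) * R (p \<circ> q)))"
      by (rule sum_permutations_compose_right[OF q])
    also have "\<dots> = (\<Sum>p\<in>?P. - (signof p * (?N' p * R p)))"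
      by (intro sum.cong refl) (simp only: sgn, simp add: R_q q_k)
    finally have G': "G k = (\<Sum>p\<in>?P. - (signof p * (?N' p * R p)))" .
    have "G (Suc k) = (\<Sum>p\<in>?P. signof p * ((?N p - ?N' p) * R p))"
      unfolding G_def split R_Suc by (simp add: t_def)
    \<comment> \<open>One copy of \<open>G k\<close> is taken in its original form, the other after
      composition with the swap \<open>q\<close>.\<close>
    also have "\<dots> = G k + G k"
      by (subst G, subst G') (simp add: sum.distrib[symmetric] algebra_simps)
    finally show ?thesis by simp
  qed
  have "G k = 2 ^ k * G 0" if "k \<le> r" for k
    using that by (induction k) (auto simp: step)
  from this[of r] show ?thesis
    by (simp add: G_def t_def pf_sum_def)
qed

text \<open>The vanishing hypotheses leave only the permutations that act separately on the even and
  on the odd indices; these are pairs of permutations of \<open>{0..<r}\<close>.\<close>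

lemma pf_sum_odd_columns:
  fixes N :: "nat \<Rightarrow> nat \<Rightarrow> 'a::comm_ring_1"
  assumes zero: "\<And>i j. i < 2 * r \<Longrightarrow> j < r \<Longrightarrow> N i (2 * j) = 0"
  shows "pf_sum r N = of_nat (fact r) * det (mat r r (\<lambda>(i, j). N (2 * i) (2 * j + 1)))"
proof -
  let ?P = "{p. p permutes {0..<r}}"
  let ?Q = "{p. p permutes {0..<2 * r} \<and> (\<forall>i<r. odd (p (2 * i + 1)))}"
  let ?D = "det (mat r r (\<lambda>(i, j). N (2 * i) (2 * j + 1)))"
  let ?E = "map_permutation {0..<r} (\<lambda>i. 2 * i :: nat)"
  let ?O = "map_permutation {0..<r} (\<lambda>i. 2 * i + 1 :: nat)"
  \<comment> \<open>\<alpha> acts on the even indices and \<beta> on the odd ones. \<open>F\<close>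
    will be a bijection from pairs onto \<open>?Q\<close>.\<close>
  define F where "F = (\<lambda>(\<alpha>, \<beta>). ?E \<alpha> \<circ> ?O \<beta>)"
  have E: "?E \<alpha> permutes (\<lambda>i. 2 * i) ` {0..<r}" if "\<alpha> \<in> ?P" for \<alpha>
    using that by (simp add: map_permutation_permutes bij_betw_def inj_on_def)
  have O: "?O \<beta> permutes (\<lambda>i. 2 * i + 1) ` {0..<r}" if "\<beta> \<in> ?P" for \<beta>
    using that by (simp add: map_permutation_permutes bij_betw_def inj_on_def)
  have F_even: "F (\<alpha>, \<beta>) (2 * i) = 2 * \<alpha> i" and F_odd: "F (\<alpha>, \<beta>) (2 * i + 1) = 2 * \<beta> i + 1"
    if "\<alpha> \<in> ?P" "\<beta> \<in> ?P" "i < r" for \<alpha> \<beta> i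
  proof -
    have "2 * i \<notin> (\<lambda>i. 2 * i + 1) ` {0..<r}" by clarsimp presburger
    then have "?O \<beta> (2 * i) = 2 * i" by (rule permutes_not_in[OF O[OF that(2)]])
    moreover have "?E \<alpha> (2 * i) = 2 * \<alpha> i"
      using that map_permutation_apply[of "\<lambda>i. 2 * i" "{0..<r}" i \<alpha>] by (simp add: inj_on_def)
    ultimately show "F (\<alpha>, \<beta>) (2 * i) = 2 * \<alpha> i" by (simp add: F_def)
    have "2 * \<beta> i + 1 \<notin> (\<lambda>i. 2 * i) ` {0..<r}" by clarsimp presburger
    then have "?E \<alpha> (2 * \<beta> i + 1) = 2 * \<beta> i + 1" by (rule permutes_not_in[OF E[OF that(1)]])
    moreover have "?O \<beta> (2 * i + 1) = 2 * \<beta> i + 1"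
      using that map_permutation_apply[of "\<lambda>i. 2 * i + 1" "{0..<r}" i \<beta>] by (simp add: inj_on_def)
    ultimately show "F (\<alpha>, \<beta>) (2 * i + 1) = 2 * \<beta> i + 1" by (simp add: F_def)
  qed
  have F_permutes: "F (\<alpha>, \<beta>) permutes {0..<2 * r}" if "\<alpha> \<in> ?P" "\<beta> \<in> ?P" for \<alpha> \<beta>
    unfolding F_def prod.case
    by (intro permutes_compose permutes_subset[OF E] permutes_subset[OF O] that) auto
  have sgn: "signof (F (\<alpha>, \<beta>)) = (signof \<alpha> * signof \<beta> :: 'a)" if "\<alpha> \<in> ?P" "\<beta> \<in> ?P" for \<alpha> \<beta>
  proof -
    have "permutation (?E \<alpha>)" "permutation (?O \<beta>)"
      using E[OF that(1)] O[OF that(2)] permutation_permutes by blast+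
    moreover have "sign (?E \<alpha>) = sign \<alpha>" "sign (?O \<beta>) = sign \<beta>"
      using that by (auto intro!: sign_map_permutation simp: inj_on_def)
    ultimately show ?thesis by (simp add: F_def sign_compose)
  qed
  have inj: "inj_on F (?P \<times> ?P)"
  proof (intro inj_onI, clarify)
    fix \<alpha> \<beta> \<alpha>' \<beta>'
    assume p: "\<alpha> permutes {0..<r}" "\<beta> permutes {0..<r}" "\<alpha>' permutes {0..<r}" "\<beta>' permutes {0..<r}"
      and eq: "F (\<alpha>, \<beta>) = F (\<alpha>', \<beta>')"
    have "\<alpha> i = \<alpha>' i \<and> \<beta> i = \<beta>' i" for i
    proof (cases "i < r")
      case True
      then show ?thesis
        using F_even[of \<alpha> \<beta> i] F_even[of \<alpha>' \<beta>' i] F_odd[of \<alpha> \<beta> i] F_odd[of \<alpha>' \<beta>' i] p eq by simp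
    next
      case False
      then show ?thesis using p by (simp add: permutes_not_in)
    qed
    then show "\<alpha> = \<alpha>' \<and> \<beta> = \<beta>'" by (simp add: fun_eq_iff)
  qed
  have image: "F ` (?P \<times> ?P) = ?Q"
  proof (intro equalityI subsetI)
    fix p assume "p \<in> F ` (?P \<times> ?P)"
    then show "p \<in> ?Q" using F_permutes F_odd by auto
  next
    fix p assume "p \<in> ?Q"
    then have p: "p permutes {0..<2 * r}" and odd_odd: "\<And>i. i < r \<Longrightarrow> odd (p (2 * i + 1))" by auto
    have less: "p i < 2 * r" if "i < 2 * r" for i
      using that permutes_in_image[OF p, of i] by simp
    have inj_p: "p i = p j \<longleftrightarrow> i = j" for i j
      using permutes_inj[OF p] by (auto dest: injD)
    let ?B = "(\<lambda>i. 2 * i + 1) ` {0..<r}"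
    have "p ` ?B \<subseteq> ?B"
    proof
      fix x assume "x \<in> p ` ?B"
      then obtain i where "i < r" "x = p (2 * i + 1)" by auto
      then have "odd x" "x < 2 * r" using odd_odd less[of "2 * i + 1"] by auto
      then show "x \<in> ?B" by (intro image_eqI[of _ _ "x div 2"]) auto
    qed
    \<comment> \<open>An injection of the finite set of odd indices into itself is onto, which
      leaves no odd value for an even index.\<close>
    then have onto: "p ` ?B = ?B"
      using permutes_inj_on[OF p] by (intro endo_inj_surj) auto
    have even_even: "even (p (2 * i))" if "i < r" for i
    proof (rule ccontr)
      assume "odd (p (2 * i))"
      then have "p (2 * i) \<in> ?B"
        using less[of "2 * i"] that by (intro image_eqI[of _ _ "p (2 * i) div 2"]) auto
      then obtain j where "p (2 * i) = p (2 * j + 1)" using onto by (metis (no_types, lifting) imageE)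
      then show False by (simp add: inj_p) presburger
    qed
    define \<alpha> where "\<alpha> i = (if i < r then p (2 * i) div 2 else i)" for i
    define \<beta> where "\<beta> i = (if i < r then p (2 * i + 1) div 2 else i)" for i
    have \<alpha>: "2 * \<alpha> i = p (2 * i)" and \<beta>: "2 * \<beta> i + 1 = p (2 * i + 1)" if "i < r" for i
      using that even_even[OF that] odd_odd[OF that] by (auto simp: \<alpha>_def \<beta>_def)
    have \<alpha>_perm: "\<alpha> permutes {0..<r}"
    proof (rule inj_imp_permutes)
      show "inj_on \<alpha> {0..<r}"
      proof (rule inj_onI)
        fix i j assume "i \<in> {0..<r}" "j \<in> {0..<r}" "\<alpha> i = \<alpha> j"
        then have "p (2 * i) = p (2 * j)" using \<alpha>[of i] \<alpha>[of j] by simp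
        then show "i = j" by (simp add: inj_p)
      qed
      show "\<alpha> i \<in> {0..<r}" if "i \<in> {0..<r}" for i
        using that less[of "2 * i"] \<alpha>[of i] by simp
    qed (auto simp: \<alpha>_def)
    have \<beta>_perm: "\<beta> permutes {0..<r}"
    proof (rule inj_imp_permutes)
      show "inj_on \<beta> {0..<r}"
      proof (rule inj_onI)
        fix i j assume "i \<in> {0..<r}" "j \<in> {0..<r}" "\<beta> i = \<beta> j"
        then have "p (2 * i + 1) = p (2 * j + 1)" using \<beta>[of i] \<beta>[of j] by simp
        then show "i = j" by (simp add: inj_p)
      qed
      show "\<beta> i \<in> {0..<r}" if "i \<in> {0..<r}" for i
        using that less[of "2 * i + 1"] \<beta>[of i] by simp
    qed (auto simp: \<beta>_def)
    have "F (\<alpha>, \<beta>) x = p x" for x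
    proof (cases "x < 2 * r")
      case True
      show ?thesis
      proof (cases "even x")
        case True
        then obtain i where i: "x = 2 * i" by blast
        with \<open>x < 2 * r\<close> have "i < r" by simp
        then show ?thesis using F_even[of \<alpha> \<beta> i] \<alpha> \<alpha>_perm \<beta>_perm i by simp
      next
        case False
        then obtain i where i: "x = 2 * i + 1" by (elim oddE)
        with \<open>x < 2 * r\<close> have "i < r" by simp
        then show ?thesis using F_odd[of \<alpha> \<beta> i] \<beta>[of i] \<alpha>_perm \<beta>_perm i by simp
      qed
    next
      case False
      then show ?thesis
        using F_permutes[of \<alpha> \<beta>] \<alpha>_perm \<beta>_perm p by (simp add: permutes_not_in)
    qed
    then have "p = F (\<alpha>, \<beta>)" by (simp add: fun_eq_iff)
    then show "p \<in> F ` (?P \<times> ?P)" using \<alpha>_perm \<beta>_perm by blast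
  qed
  have "pf_sum r N = (\<Sum>p\<in>?Q. signof p * (\<Prod>i = 0..<r. N (p (2 * i)) (p (2 * i + 1))))"
    unfolding pf_sum_def
  proof (rule sum.mono_neutral_right)
    show "\<forall>p \<in> {p. p permutes {0..<2 * r}} - ?Q.
        signof p * (\<Prod>i = 0..<r. N (p (2 * i)) (p (2 * i + 1))) = 0"
    proof
      fix p assume p: "p \<in> {p. p permutes {0..<2 * r}} - ?Q"
      \<comment> \<open>Some factor takes its second index from an even column, where
        \<open>N\<close> is zero.\<close>
      then obtain i where i: "i < r" "even (p (2 * i + 1))" by auto
      have "p (2 * i) < 2 * r" "p (2 * i + 1) < 2 * r"
        using p i permutes_in_image[of p "{0..<2 * r}"] by auto
      then have "N (p (2 * i)) (p (2 * i + 1)) = 0"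
        using zero[of "p (2 * i)" "p (2 * i + 1) div 2"] i by simp
      then have "(\<Prod>i = 0..<r. N (p (2 * i)) (p (2 * i + 1))) = 0"
        using i by (intro prod_zero) auto
      then show "signof p * (\<Prod>i = 0..<r. N (p (2 * i)) (p (2 * i + 1))) = 0" by simp
    qed
  qed (auto intro: finite_permutations)
  also have "\<dots> = (\<Sum>x\<in>?P \<times> ?P. signof (F x) * (\<Prod>i = 0..<r. N (F x (2 * i)) (F x (2 * i + 1))))"
    unfolding image[symmetric] by (subst sum.reindex[OF inj]) simp
  also have "\<dots> = (\<Sum>(\<alpha>, \<beta>)\<in>?P \<times> ?P.
      signof \<alpha> * (signof \<beta> * (\<Prod>i = 0..<r. N (2 * \<alpha> i) (2 * \<beta> i + 1))))"
  proof (rule sum.cong)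
    fix x assume "x \<in> ?P \<times> ?P"
    then obtain \<alpha> \<beta> where x: "x = (\<alpha>, \<beta>)" "\<alpha> \<in> ?P" "\<beta> \<in> ?P" by blast
    then have "(\<Prod>i = 0..<r. N (F x (2 * i)) (F x (2 * i + 1))) =
        (\<Prod>i = 0..<r. N (2 * \<alpha> i) (2 * \<beta> i + 1))"
      by (intro prod.cong) (simp_all only: F_even F_odd atLeastLessThan_iff)
    then show "signof (F x) * (\<Prod>i = 0..<r. N (F x (2 * i)) (F x (2 * i + 1))) =
        (case x of (\<alpha>, \<beta>) \<Rightarrow>
          signof \<alpha> * (signof \<beta> * (\<Prod>i = 0..<r. N (2 * \<alpha> i) (2 * \<beta> i + 1))))"
      using x by (simp only: sgn prod.case mult.assoc)
  qed simp
  also have "\<dots> = (\<Sum>\<alpha>\<in>?P. signof \<alpha> * (\<Sum>\<beta>\<in>?P. signof \<beta> * (\<Prod>i = 0..<r. N (2 * \<alpha> i) (2 * \<beta> i + 1))))"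
    by (simp only: sum.cartesian_product sum_distrib_left)
  \<comment> \<open>The inner sum is the determinant with rows permuted by \<alpha>; its sign
    cancels the outer one, so all r! summands agree.\<close>
  also have "\<dots> = (\<Sum>\<alpha>\<in>?P. ?D)"
  proof (rule sum.cong)
    fix \<alpha> assume "\<alpha> \<in> ?P"
    then have \<alpha>: "\<alpha> permutes {0..<r}" by simp
    let ?A = "mat r r (\<lambda>(i, j). N (2 * i) (2 * j + 1))"
    have "(\<Sum>\<beta>\<in>?P. signof \<beta> * (\<Prod>i = 0..<r. N (2 * \<alpha> i) (2 * \<beta> i + 1))) =
        det (mat r r (\<lambda>(i, j). ?A $$ (\<alpha> i, j)))"
      using permutes_in_image[OF \<alpha>]
      by (subst det_def'[of _ r]) (auto intro!: sum.cong prod.cong simp: permutes_in_image)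
    also have "\<dots> = signof \<alpha> * ?D"
      by (rule det_permute_rows[OF _ \<alpha>]) simp
    finally show "signof \<alpha> * (\<Sum>\<beta>\<in>?P. signof \<beta> * (\<Prod>i = 0..<r. N (2 * \<alpha> i) (2 * \<beta> i + 1))) = ?D"
      by (simp add: mult.assoc[symmetric] signof_mult_signof del: of_int_mult)
  qed simp
  finally show ?thesis
    by (simp add: card_permutations[of "{0..<r}" r])
qed

section \<open>The ordering by mirror pairs\<close>

text \<open>Positions 2i and 2i + 1 receive the mirror pair i, 2r - 1 - i. Arguments out of range
  are fixed, as \<open>permutes\<close> demands.\<close>

definition fold_perm :: "nat \<Rightarrow> nat \<Rightarrow> nat" where
  "fold_perm r p = (if p < 2 * r then if even p then p div 2 else 2 * r - 1 - p div 2 else p)"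

text \<open>Passing from \<open>r\<close> to \<open>r + 1\<close> composes with the square of a cycle, so the sign stays 1.\<close>

lemma fold_perm_sign: "fold_perm r permutes {0..<2 * r} \<and> sign (fold_perm r) = 1"
proof (induction r)
  case 0
  have "fold_perm 0 = id" by (simp add: fold_perm_def fun_eq_iff)
  then show ?case by (simp only: permutes_id sign_id simp_thms)
next
  case (Suc r)
  \<comment> \<open>This is the cycle r, r + 1, ..., 2r + 1. Applied twice it raises the old upper
    half by 2 and sends 2r, 2r + 1, which \<open>fold_perm r\<close> fixes, to the new middle pair
    r, r + 1.\<close>
  define \<rho> where "\<rho> v = (if r \<le> v \<and> v < 2 * r + 1 then v + 1 else if v = 2 * r + 1 then r else v)" for v
  have \<rho>: "\<rho> permutes {0..<2 * Suc r}"
    by (rule inj_imp_permutes) (auto simp: inj_on_def \<rho>_def split: if_splits)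
  have fold: "fold_perm r permutes {0..<2 * Suc r}"
    using Suc by (auto intro: permutes_subset)
  have eq: "fold_perm (Suc r) = \<rho> \<circ> \<rho> \<circ> fold_perm r"
  proof
    fix p :: nat
    define i where "i = p div 2"
    have p: "p = 2 * i \<or> p = Suc (2 * i)"
      unfolding i_def by presburger
    have "i < r \<or> i = r \<or> i > r" by linarith
    then show "fold_perm (Suc r) p = (\<rho> \<circ> \<rho> \<circ> fold_perm r) p"
      using p by (elim disjE) (simp_all add: fold_perm_def \<rho>_def, linarith)
  qed
  have "permutation \<rho>" "permutation (fold_perm r)"
    using \<rho> fold permutation_permutes by blast+
  then have "sign (fold_perm (Suc r)) = 1"
    using Suc by (simp add: eq sign_compose permutation_compose)
  moreover have "fold_perm (Suc r) permutes {0..<2 * Suc r}"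
    unfolding eq by (intro permutes_compose \<rho> fold)
  ultimately show ?case by simp
qed

section \<open>Determinant tools for the even case\<close>

lemma det_permute_rows_cols:
  assumes A: "A \<in> carrier_mat n n" and p: "p permutes {0..<n}"
  shows "det (mat n n (\<lambda>(i, j). A $$ (p i, p j))) = det A"
proof -
  let ?B = "mat n n (\<lambda>(i, j). A $$ (p i, j))"
  have "mat n n (\<lambda>(i, j). A $$ (p i, p j)) =
      transpose_mat (mat n n (\<lambda>(i, j). transpose_mat ?B $$ (p i, j)))"
    using permutes_in_image[OF p] by (intro eq_matI) auto
  then have "det (mat n n (\<lambda>(i, j). A $$ (p i, p j))) = signof p * det (transpose_mat ?B)"
    by (simp add: det_transpose[of _ n] det_permute_rows[OF _ p])
  also have "\<dots> = (signof p * signof p) * det A"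
    by (simp add: det_transpose[of _ n] det_permute_rows[OF A p] mult.assoc)
  finally show ?thesis unfolding signof_mult_signof by simp
qed

text \<open>Adding the lower block row to the upper one, then the left block column to the right
  one, clears the upper right block. Both operations are multiplication by the unimodular
  \<open>?U\<close>.\<close>

lemma det_four_block_skew:
  fixes P H :: "'a::idom mat"
  assumes P: "P \<in> carrier_mat r r" and H: "H \<in> carrier_mat r r"
  shows "det (four_block_mat P H (- H) (- P)) = det (P - H) * det (- P - H)"
proof -
  let ?M = "four_block_mat P H (- H) (- P)"
  let ?U = "four_block_mat (1\<^sub>m r) (1\<^sub>m r) (0\<^sub>m r r) (1\<^sub>m r) :: 'a mat"
  have U: "?U \<in> carrier_mat (r + r) (r + r)" by simp
  have M: "?M \<in> carrier_mat (r + r) (r + r)" using P H by simp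
  have "det ?U = 1"
    by (subst det_four_block_mat_lower_left_zero[of _ r _ r]) auto
  then have "det ?M = det (?U * ?M * ?U)"
    by (simp only: det_mult[OF mult_carrier_mat[OF U M] U] det_mult[OF U M] mult_1_left mult_1_right)
  also have "?U * ?M = four_block_mat (P - H) (H - P) (- H) (- P)"
    using P H by (subst mult_four_block_mat[of _ r r _ r _ r _ _ r _ r])
      (auto intro!: arg_cong3[where f = "\<lambda>x y. four_block_mat x y (- H)"] eq_matI)
  also have "\<dots> * ?U = four_block_mat (P - H) (0\<^sub>m r r) (- H) (- P - H)"
    using P H by (subst mult_four_block_mat[of _ r r _ r _ r _ _ r _ r])
      (auto intro!: arg_cong2[where f = "\<lambda>x y. four_block_mat (P - H) x (- H) y"] eq_matI)
  also have "det \<dots> = det (P - H) * det (- P - H)"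
    using P H by (intro det_four_block_mat_upper_right_zero) auto
  finally show ?thesis .
qed

section \<open>Skew-symmetric Toeplitz matrices\<close>

context
  fixes c :: "int \<Rightarrow> 'a::field_char_0"
  assumes c_minus: "\<And>s. c (- s) = - c s"
begin

lemma c_swap: "c (x - y) = - c (y - x)"
  using c_minus[of "y - x"] by simp

lemma det_toeplitz_even:
  "det (toeplitz_mat c (2 * r)) = (det (toeplitz_minus_hankel_mat c r))\<^sup>2"
proof -
  let ?A = "toeplitz_mat c (2 * r)" and ?B = "toeplitz_minus_hankel_mat c r"
  \<comment> \<open>Reversing the upper half puts the mirror image of k at position r + k, which
    gives the block form above.\<close>
  define q where "q i = (if r \<le> i \<and> i < 2 * r then 3 * r - 1 - i else i)" for i
  have q: "q permutes {0..<2 * r}"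
    by (rule inj_imp_permutes) (auto simp: q_def inj_on_def split: if_splits)
  define P where "P = mat r r (\<lambda>(i, j). c (int j - int i))"
  define H where "H = mat r r (\<lambda>(i, j). c (2 * int r - 1 - int i - int j))"
  have PH: "P \<in> carrier_mat r r" "H \<in> carrier_mat r r"
    by (simp_all add: P_def H_def)
  have "det ?A = det (mat (2 * r) (2 * r) (\<lambda>(i, j). ?A $$ (q i, q j)))"
    by (rule det_permute_rows_cols[OF _ q, symmetric]) (simp add: toeplitz_mat_def)
  also have "mat (2 * r) (2 * r) (\<lambda>(i, j). ?A $$ (q i, q j)) = four_block_mat P H (- H) (- P)"
  proof (rule eq_matI)
    fix i j
    assume "i < dim_row (four_block_mat P H (- H) (- P))" "j < dim_col (four_block_mat P H (- H) (- P))"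
    then have ij: "i < 2 * r" "j < 2 * r" by (auto simp: P_def H_def)
    then have q_less: "q i < 2 * r" "q j < 2 * r" using permutes_in_image[OF q] by auto
    have int_q: "int (q k) = (if r \<le> k then 3 * int r - 1 - int k else int k)" if "k < 2 * r" for k
      using that by (auto simp: q_def)
    show "mat (2 * r) (2 * r) (\<lambda>(i, j). ?A $$ (q i, q j)) $$ (i, j) =
        four_block_mat P H (- H) (- P) $$ (i, j)"
      using ij q_less
      by (auto simp: toeplitz_mat_def P_def H_def int_q of_nat_diff algebra_simps
          simp flip: c_minus intro!: arg_cong[where f = c])
  qed (auto simp: P_def H_def)
  also have "det \<dots> = det (P - H) * det (- P - H)"
    by (rule det_four_block_skew[OF PH])
  also have "P - H = ?B"
    by (intro eq_matI) (auto simp: P_def H_def toeplitz_minus_hankel_mat_def algebra_simps)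
  \<comment> \<open>\<open>P\<close> is skew and \<open>H\<close> symmetric, so this is the
    transpose of \<open>P - H\<close>.\<close>
  also have "- P - H = transpose_mat ?B"
    by (intro eq_matI) (auto simp: P_def H_def toeplitz_minus_hankel_mat_def algebra_simps
        simp flip: c_minus)
  also have "det (transpose_mat ?B) = det ?B"
    by (rule det_transpose[of _ r]) (simp add: toeplitz_minus_hankel_mat_def)
  finally show ?thesis by (simp add: power2_eq_square)
qed

lemma det_toeplitz_odd: "det (toeplitz_mat c (2 * r + 1)) = 0"
proof -
  let ?A = "toeplitz_mat c (2 * r + 1)"
  have A: "?A \<in> carrier_mat (2 * r + 1) (2 * r + 1)" by (simp add: toeplitz_mat_def)
  have "transpose_mat ?A = (- 1) \<cdot>\<^sub>m ?A"
  proof (rule eq_matI)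
    fix i j assume "i < dim_row ((- 1) \<cdot>\<^sub>m ?A)" "j < dim_col ((- 1) \<cdot>\<^sub>m ?A)"
    then show "transpose_mat ?A $$ (i, j) = ((- 1) \<cdot>\<^sub>m ?A) $$ (i, j)"
      using c_swap[of "int i" "int j"] by (simp add: toeplitz_mat_def)
  qed (auto simp: toeplitz_mat_def)
  then have "det ?A = det ((- 1) \<cdot>\<^sub>m ?A)"
    using det_transpose[OF A] by simp
  \<comment> \<open>The scalar -1 enters with the odd exponent 2r + 1; in characteristic 0 the
    determinant must then vanish.\<close>
  then have "det ?A = - det ?A"
    by (simp add: toeplitz_mat_def)
  then show ?thesis by simp
qed

text \<open>In the ordering \<open>0, 2 r - 1, 1, 2 r - 2, \<dots>\<close> given by \<open>fold_perm\<close>, adding each odd row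
  and column to the preceding even one makes the even-even block vanish, because \<open>A\<close> changes its
  sign under reversal of both indices.\<close>

lemma pfaffian_toeplitz:
  "pfaffian (toeplitz_mat c (2 * r)) = (- 1) ^ r * det (toeplitz_minus_hankel_mat c r)"
proof -
  let ?A = "toeplitz_mat c (2 * r)" and ?B = "toeplitz_minus_hankel_mat c r"
  let ?q = "fold_perm r"
  have q: "?q permutes {0..<2 * r}" and sgn: "sign ?q = 1"
    using fold_perm_sign by auto
  define a where "a i j = ?A $$ (?q i, ?q j)" for i j
  \<comment> \<open>The entries off the diagonal are at (2m, 2m + 1), so \<open>S\<close> is unit
    upper triangular and the congruence preserves the Pfaffian sum.\<close>
  define S :: "nat \<Rightarrow> nat \<Rightarrow> 'a" where "S i k = (if k = i \<or> even i \<and> k = i + 1 then 1 else 0)" for i k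
  \<comment> \<open>Chosen so that \<open>N i j - N j i\<close> is the congruent matrix while all
    even columns of \<open>N\<close> vanish: the even-odd block is kept whole, and the skew odd-odd
    block is halved.\<close>
  define N where "N i j = (if odd j then if even i then - ?B $$ (i div 2, j div 2) else a i j / 2 else 0)"
    for i j
  have a: "a i j = c (int (?q j) - int (?q i))" if "i < 2 * r" "j < 2 * r" for i j
    using that permutes_in_image[OF q] by (auto simp: a_def toeplitz_mat_def)
  have q_even: "?q (2 * i) = i" and q_odd: "int (?q (Suc (2 * i))) = 2 * int r - 1 - int i" if "i < r" for i
    using that by (auto simp: fold_perm_def)
  have a_ee: "a (2 * i) (2 * j) = c (int j - int i)"
    and a_eo: "a (2 * i) (Suc (2 * j)) = c (2 * int r - 1 - int i - int j)"
    and a_oe: "a (Suc (2 * i)) (2 * j) = - c (2 * int r - 1 - int i - int j)"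
    and a_oo: "a (Suc (2 * i)) (Suc (2 * j)) = - c (int j - int i)" if "i < r" "j < r" for i j
    using that by (simp_all add: a q_even q_odd) (simp_all add: algebra_simps flip: c_minus)
  have B: "?B $$ (i, j) = c (int j - int i) - c (2 * int r - 1 - int i - int j)" if "i < r" "j < r" for i j
    using that by (simp add: toeplitz_minus_hankel_mat_def algebra_simps)
  have det_S: "det (mat (2 * r) (2 * r) (\<lambda>(i, j). S i j)) = 1"
    by (subst det_upper_triangular[of _ "2 * r"]) (auto simp: S_def prod_list_diag_prod)
  have S_sum: "(\<Sum>k<2 * r. S i k * f k) = (if even i then f i + f (i + 1) else f i)"
    if "i < 2 * r" for i and f :: "nat \<Rightarrow> 'a"
  proof -
    have "(\<Sum>k<2 * r. S i k * f k) = (\<Sum>k\<in>(if even i then {i, i + 1} else {i}). f k)"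
      using that by (intro sum.mono_neutral_cong_right) (auto simp: S_def split: if_splits elim!: evenE)
    then show ?thesis by simp
  qed
  have "pf_sum r (\<lambda>i j. ?A $$ (i, j)) = pf_sum r a"
    unfolding a_def using pf_sum_relabel[OF q, of "\<lambda>i j. ?A $$ (i, j)"] by (simp add: sgn)
  also have "\<dots> = pf_sum r (\<lambda>i j. \<Sum>k<2 * r. \<Sum>l<2 * r. S i k * a k l * S j l)"
    by (simp add: pf_sum_congruence det_S)
  also have "\<dots> = pf_sum r (\<lambda>i j. N i j - N j i)"
  proof (rule pf_sum_cong)
    fix i j assume ij: "i < 2 * r" "j < 2 * r"
    have "(\<Sum>k<2 * r. \<Sum>l<2 * r. S i k * a k l * S j l) =
        (\<Sum>k<2 * r. S i k * (\<Sum>l<2 * r. S j l * a k l))"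
      by (simp add: sum_distrib_left mult_ac)
    also have "\<dots> = N i j - N j i"
    proof -
      obtain m n where "i = 2 * m \<or> i = Suc (2 * m)" "j = 2 * n \<or> j = Suc (2 * n)"
        by (metis evenE oddE Suc_eq_plus1)
      with ij have "m < r" "n < r" by auto
      with ij \<open>i = _ \<or> _\<close> \<open>j = _ \<or> _\<close> show ?thesis
        unfolding S_sum[OF ij(1)] S_sum[OF ij(2)]
        by (elim disjE)
          (simp_all add: N_def a_ee a_eo a_oe a_oo B c_swap[of "int m" "int n"], simp_all add: algebra_simps)
    qed
    finally show "(\<Sum>k<2 * r. \<Sum>l<2 * r. S i k * a k l * S j l) = N i j - N j i" .
  qed
  \<comment> \<open>Only the even-odd block of \<open>N\<close> survives. The factors 2^r and r!
    will cancel the normalisation of the Pfaffian.\<close>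
  also have "\<dots> = 2 ^ r * (of_nat (fact r) * det (mat r r (\<lambda>(i, j). N (2 * i) (2 * j + 1))))"
    unfolding pf_sum_antisymmetrize by (subst pf_sum_odd_columns) (auto simp: N_def)
  also have "mat r r (\<lambda>(i, j). N (2 * i) (2 * j + 1)) = (- 1) \<cdot>\<^sub>m ?B"
    by (intro eq_matI) (auto simp: N_def toeplitz_minus_hankel_mat_def)
  also have "det \<dots> = (- 1) ^ r * det ?B"
    by (simp add: toeplitz_minus_hankel_mat_def)
  finally have "pf_sum r (\<lambda>i j. ?A $$ (i, j)) = 2 ^ r * fact r * ((- 1) ^ r * det ?B)"
    by simp
  moreover have "?A \<in> carrier_mat (2 * r) (2 * r)" by (simp add: toeplitz_mat_def)
  ultimately show ?thesis by (simp add: pfaffian_eq_pf_sum)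
qed

end

theorem proposition3p10:
  fixes c :: "int \<Rightarrow> complex" and r :: nat
  assumes "c 0 = 0"
    and "\<And>s. c (- s) = - c s"
    and "r \<ge> 1"
  shows "det (toeplitz_mat c (2 * r)) = (det (toeplitz_minus_hankel_mat c r))\<^sup>2
    \<and> pfaffian (toeplitz_mat c (2 * r)) = (- 1) ^ r * det (toeplitz_minus_hankel_mat c r)
    \<and> det (toeplitz_mat c (2 * r + 1)) = 0"
  by (intro conjI det_toeplitz_even pfaffian_toeplitz det_toeplitz_odd assms(2))

end
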